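(* If $G$ is a 5-regular (quintic) graph of order $8$, then $\chi_{la}(G)=\chi(G)=4$.
   Context: $\chi(G)$ is the chromatic number. For a simple graph $G=(V,E)$ with $q$ edges, a bijection $f:E\to\{1,\dots,q\}$ is a local antimagic labeling if $f^+(u)\neq f^+(v)$ for every edge $uv$, where $f^+(u)=\sum_{e\ni u} f(e)$. The local antimagic chromatic number $\chi_{la}(G)$ is the minimum number of distinct values of $f^+$ over all local antimagic labelings $f$ of $G$. *)

theory Defs
  imports "HOL-Library.Extended_Nat"
begin

definition simple_graph :: "'a set \<Rightarrow> 'a set set \<Rightarrow> bool" where
  "simple_graph V E \<longleftrightarrow> finite V \<and> (\<forall>e\<in>E. e \<subseteq> V \<and> card e = 2)"

definition incident_edges :: "'a set set \<Rightarrow> 'a \<Rightarrow> 'a set set" where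
  "incident_edges E u = {e \<in> E. u \<in> e}"

definition regular_graph :: "'a set \<Rightarrow> 'a set set \<Rightarrow> nat \<Rightarrow> bool" where
  "regular_graph V E r \<longleftrightarrow> (\<forall>u\<in>V. card (incident_edges E u) = r)"

definition proper_colouring :: "'a set \<Rightarrow> 'a set set \<Rightarrow> ('a \<Rightarrow> nat) \<Rightarrow> bool" where
  "proper_colouring V E c \<longleftrightarrow> (\<forall>u\<in>V. \<forall>v\<in>V. {u, v} \<in> E \<longrightarrow> c u \<noteq> c v)"

definition chromatic_number :: "'a set \<Rightarrow> 'a set set \<Rightarrow> enat" where
  "chromatic_number V E = Inf {enat (card (c ` V)) | c. proper_colouring V E c}"

definition vertex_sum :: "'a set set \<Rightarrow> ('a set \<Rightarrow> nat) \<Rightarrow> 'a \<Rightarrow> nat" where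
  "vertex_sum E f u = (\<Sum>e\<in>incident_edges E u. f e)"

definition local_antimagic_labeling ::
    "'a set \<Rightarrow> 'a set set \<Rightarrow> ('a set \<Rightarrow> nat) \<Rightarrow> bool" where
  "local_antimagic_labeling V E f \<longleftrightarrow>
     bij_betw f E {1..card E} \<and>
     (\<forall>u\<in>V. \<forall>v\<in>V. {u, v} \<in> E \<longrightarrow> vertex_sum E f u \<noteq> vertex_sum E f v)"

text \<open>The value is \<open>\<infinity>\<close> exactly when there is no local antimagic labeling.\<close>

definition local_antimagic_chromatic_number :: "'a set \<Rightarrow> 'a set set \<Rightarrow> enat" where
  "local_antimagic_chromatic_number V E =
     Inf {enat (card (vertex_sum E f ` V)) | f. local_antimagic_labeling V E f}"

end

theory Submission
  imports Defs
begin

text \<open>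
  The complement of a quintic graph of order 8 is 2-regular, hence one of \<open>C\<^sub>8\<close>, \<open>C\<^sub>4 + C\<^sub>4\<close> and
  \<open>C\<^sub>3 + C\<^sub>5\<close>. A colour class containing a vertex \<open>u\<close> lies in \<open>u\<close> plus its two non-neighbours;
  so classes have at most three vertices, with equality only for a triangle component
  of the complement, and three classes cannot cover 8 vertices. The sums of a local antimagic labeling
  form a proper colouring, so it remains to exhibit, for each of the three graphs, a labeling with four
  sums.
\<close>

section \<open>Cycle decomposition of 2-regular graphs\<close>

text \<open>The graph is given by its neighbourhood function. \<open>N\<close> is constrained only
  on \<open>W\<close>, so removing a component shrinks \<open>W\<close> and keeps
  \<open>N\<close>.\<close>

definition two_regular :: "'a set \<Rightarrow> ('a \<Rightarrow> 'a set) \<Rightarrow> bool" where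
  "two_regular W N \<longleftrightarrow>
     finite W \<and> (\<forall>u\<in>W. N u \<subseteq> W - {u} \<and> card (N u) = 2 \<and> (\<forall>v\<in>N u. u \<in> N v))"

text \<open>\<open>N\<close> is prescribed in full at each vertex, so the cycle is a whole component
  and not merely a subgraph. The order successor, predecessor is that of the tables in the
  certificates.\<close>

definition is_cycle :: "('a \<Rightarrow> 'a set) \<Rightarrow> 'a list \<Rightarrow> bool" where
  "is_cycle N xs \<longleftrightarrow> distinct xs \<and> 3 \<le> length xs \<and>
     (\<forall>i<length xs. N (xs ! i) =
        {xs ! (if Suc i = length xs then 0 else Suc i), xs ! (if i = 0 then length xs - 1 else i - 1)})"

definition is_path :: "'a set \<Rightarrow> ('a \<Rightarrow> 'a set) \<Rightarrow> 'a list \<Rightarrow> bool" where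
  "is_path W N xs \<longleftrightarrow> distinct xs \<and> set xs \<subseteq> W \<and> (\<forall>i. Suc i < length xs \<longrightarrow> xs ! Suc i \<in> N (xs ! i))"

lemma card_2_eq_doubleton:
  assumes "card A = 2" "x \<in> A" "y \<in> A" "x \<noteq> y"
  shows "A = {x, y}"
  using assms by (auto simp: card_2_iff)

text \<open>Paths have at most \<open>card W\<close> vertices, so a longest one exists; a vertex
  placed between its two neighbours is a path with three.\<close>

lemma two_regular_longest_path:
  assumes "two_regular W N" "W \<noteq> {}"
  obtains xs where "is_path W N xs" "3 \<le> length xs"
    "\<And>ys. is_path W N ys \<Longrightarrow> length ys \<le> length xs"
proof -
  have bound: "length ys \<le> card W" if "is_path W N ys" for ys
    using that assms(1) unfolding is_path_def two_regular_def
    by (metis card_mono distinct_card)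
  obtain a where a: "a \<in> W" using assms(2) by blast
  obtain b c where bc: "N a = {b, c}" "b \<noteq> c"
    using assms(1) a unfolding two_regular_def by (metis card_2_iff)
  have "a \<notin> {b, c}" "{b, c} \<subseteq> W" "a \<in> N b"
    using assms(1) a bc unfolding two_regular_def by blast+
  then have bac: "is_path W N [b, a, c]" using a bc by (auto simp: is_path_def less_Suc_eq)
  have "\<exists>xs. is_path W N xs \<and> (\<forall>ys. is_path W N ys \<longrightarrow> length ys \<le> length xs)"
    using ex_has_greatest_nat[of "is_path W N", OF bac, of length "Suc (card W)"] bound by (simp add: less_Suc_eq_le)
  then obtain xs where xs: "is_path W N xs" "\<forall>ys. is_path W N ys \<longrightarrow> length ys \<le> length xs"
    by (elim exE conjE)
  have "3 \<le> length xs" using xs(2)[rule_format, OF bac] by simp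
  then show ?thesis using that[OF xs(1)] xs(2) by metis
qed

text \<open>The end \<open>l\<close> of a longest path has a neighbour \<open>w\<close> besides its
  predecessor. By maximality \<open>w\<close> is on the path, and inner vertices already have both
  neighbours there, so \<open>w\<close> is the first vertex and the path closes up.\<close>

lemma two_regular_imp_cycle:
  assumes reg: "two_regular W N" and "W \<noteq> {}"
  obtains xs where "set xs \<subseteq> W" "is_cycle N xs"
proof -
  obtain xs where path: "is_path W N xs" and len: "3 \<le> length xs"
    and longest: "\<And>ys. is_path W N ys \<Longrightarrow> length ys \<le> length xs"
    using two_regular_longest_path[OF assms] by blast
  let ?n = "length xs"
  have dist: "distinct xs" and sub: "set xs \<subseteq> W"
    and step: "\<And>i. Suc i < ?n \<Longrightarrow> xs ! Suc i \<in> N (xs ! i)"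
    using path unfolding is_path_def by auto
  have W: "xs ! i \<in> W" if "i < ?n" for i using sub that by auto
  have sym: "v \<in> N u \<Longrightarrow> u \<in> N v" if "u \<in> W" for u v
    using reg that unfolding two_regular_def by blast
  have card2: "card (N u) = 2" and irr: "u \<notin> N u" and clo: "N u \<subseteq> W" if "u \<in> W" for u
    using reg that unfolding two_regular_def by blast+
  have pred: "xs ! i \<in> N (xs ! Suc i)" if "Suc i < ?n" for i
    using sym[OF W step] that by simp
  have inner: "N (xs ! Suc i) = {xs ! Suc (Suc i), xs ! i}" if "Suc (Suc i) < ?n" for i
    using that dist by (intro card_2_eq_doubleton card2 W step pred) (auto simp: nth_eq_iff_index_eq)
  define l where "l = xs ! (?n - 1)"
  have l: "l \<in> W" using W[of "?n - 1"] len by (simp add: l_def)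
  have prev: "xs ! (?n - 2) \<in> N l"
  proof -
    have "Suc (?n - 2) = ?n - 1" using len by simp
    then show ?thesis using pred[of "?n - 2"] len by (simp add: l_def)
  qed
  obtain w where w: "w \<in> N l" "w \<noteq> xs ! (?n - 2)"
    using card2[OF l] by (metis card_2_iff insert_iff)
  have "w \<in> set xs"
  proof (rule ccontr)
    assume "w \<notin> set xs"
    moreover have "(xs @ [w]) ! Suc i \<in> N ((xs @ [w]) ! i)" if "Suc i < length (xs @ [w])" for i
    proof (cases "Suc i = ?n")
      case True
      then have "i = ?n - 1" by simp
      then show ?thesis using True w(1) len by (simp add: nth_append l_def)
    next
      case False
      then show ?thesis using that step by (auto simp: nth_append)
    qed
    ultimately have "is_path W N (xs @ [w])"
      using path w clo[OF l] unfolding is_path_def by auto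
    from longest[OF this] show False by simp
  qed
  then obtain k where k: "k < ?n" "w = xs ! k" by (auto simp: in_set_conv_nth)
  \<comment> \<open>Otherwise \<open>w\<close> is an inner vertex, and its neighbour
    \<open>l\<close>, being last, must be its successor; then \<open>w\<close> is the predecessor of
    \<open>l\<close>, which was excluded.\<close>
  have "k = 0"
  proof (rule ccontr)
    assume "k \<noteq> 0"
    then obtain j where j: "k = Suc j" by (cases k) auto
    have "k \<noteq> ?n - 1" using w(1) irr[OF l] k by (auto simp: l_def)
    then have j': "Suc (Suc j) < ?n" using k j by simp
    have "l \<in> N (xs ! Suc j)" using sym[OF l w(1)] k j by simp
    then have "?n - 1 = Suc (Suc j) \<or> ?n - 1 = j"
      using inner[OF j'] dist j' unfolding l_def by (auto simp: nth_eq_iff_index_eq)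
    then have "k = ?n - 2" using j j' by auto
    then show False using w(2) k by simp
  qed
  then have w0: "xs ! 0 \<in> N l" using w k by simp
  have Nl: "N l = {xs ! 0, xs ! (?n - 2)}"
    using w \<open>k = 0\<close> k by (intro card_2_eq_doubleton card2 l prev w0) auto
  have N0: "N (xs ! 0) = {xs ! 1, l}"
    using len dist step[of 0] sym[OF l w0]
    by (intro card_2_eq_doubleton card2 W) (auto simp: nth_eq_iff_index_eq l_def)
  have "N (xs ! i) = {xs ! (if Suc i = ?n then 0 else Suc i), xs ! (if i = 0 then ?n - 1 else i - 1)}"
    if "i < ?n" for i
  proof -
    consider "i = 0" | "i = ?n - 1" "i \<noteq> 0" | j where "i = Suc j" "Suc (Suc j) < ?n"
    proof (cases i)
      case (Suc j)
      then show ?thesis using that \<open>i < ?n\<close> by (cases "Suc (Suc j) < ?n") auto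
    qed (use that in blast)
    then show ?thesis
    proof cases
      case 1 then show ?thesis using N0 len by (auto simp: l_def)
    next
      case 2
      then have "Suc i = ?n" "i - 1 = ?n - 2" using len by auto
      then show ?thesis using Nl 2 by (simp add: l_def)
    next
      case 3 then show ?thesis using inner by simp
    qed
  qed
  then have "is_cycle N xs" using dist len by (simp add: is_cycle_def)
  with sub show ?thesis using that by blast
qed

lemma is_cycle_nth:
  assumes "is_cycle N xs" "i < length xs"
  shows "N (xs ! i) =
    {xs ! (if Suc i = length xs then 0 else Suc i), xs ! (if i = 0 then length xs - 1 else i - 1)}"
  using assms by (simp add: is_cycle_def)

lemma less_8_cases:
  "(i :: nat) < 8 \<Longrightarrow> i = 0 \<or> i = 1 \<or> i = 2 \<or> i = 3 \<or> i = 4 \<or> i = 5 \<or> i = 6 \<or> i = 7"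
  by linarith

section \<open>Components of a 2-regular graph on 8 vertices\<close>

lemma is_cycle_closed:
  assumes "is_cycle N xs" "u \<in> set xs"
  shows "N u \<subseteq> set xs"
proof -
  obtain i where "i < length xs" "u = xs ! i" using assms(2) by (auto simp: in_set_conv_nth)
  moreover from this have "(if Suc i = length xs then 0 else Suc i) < length xs"
    "(if i = 0 then length xs - 1 else i - 1) < length xs" by auto
  ultimately show ?thesis
    using assms(1) unfolding is_cycle_def by (metis insert_subset empty_subsetI nth_mem)
qed

lemma two_regular_diff_cycle:
  assumes "two_regular W N" "is_cycle N xs"
  shows "two_regular (W - set xs) N"
  using assms(1) is_cycle_closed[OF assms(2)] unfolding two_regular_def by blast

lemma two_regular_card_ge_3:
  assumes "two_regular W N" "W \<noteq> {}"
  shows "3 \<le> card W"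
proof -
  obtain xs where "set xs \<subseteq> W" "is_cycle N xs" using two_regular_imp_cycle[OF assms] .
  moreover have "finite W" using assms(1) by (simp add: two_regular_def)
  ultimately show ?thesis
    using card_mono[of W "set xs"] by (simp add: is_cycle_def distinct_card)
qed

text \<open>Split off one cycle, then a second one if vertices remain. Both lengths are at least 3
  and add up to 8.\<close>

lemma two_regular_card_8_cases:
  assumes reg: "two_regular W N" and card: "card W = 8"
  obtains
    (C8) xs where "is_cycle N xs" "length xs = 8" "set xs = W"
  | (C4_C4) xs ys where "is_cycle N xs" "is_cycle N ys" "length xs = 4" "length ys = 4"
      "set xs \<inter> set ys = {}" "set xs \<union> set ys = W"
  | (C3_C5) xs ys where "is_cycle N xs" "is_cycle N ys" "length xs = 3" "length ys = 5"
      "set xs \<inter> set ys = {}" "set xs \<union> set ys = W"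
proof -
  have fin: "finite W" and "W \<noteq> {}" using reg card by (auto simp: two_regular_def)
  then obtain xs where xs: "set xs \<subseteq> W" "is_cycle N xs" using two_regular_imp_cycle reg by blast
  define U where "U = W - set xs"
  have U: "two_regular U N" using two_regular_diff_cycle[OF reg xs(2)] by (simp add: U_def)
  have lx: "card (set xs) = length xs" "3 \<le> length xs"
    using xs(2) by (auto simp: is_cycle_def distinct_card)
  have cU: "card U + length xs = 8"
    using xs(1) fin card lx(1) card_mono[OF fin xs(1)] by (simp add: U_def card_Diff_subset)
  show ?thesis
  proof (cases "U = {}")
    case True
    then have "set xs = W" "length xs = 8" using xs(1) cU by (auto simp: U_def)
    then show ?thesis using C8 xs(2) by blast
  next
    case False
    then obtain ys where ys: "set ys \<subseteq> U" "is_cycle N ys" using two_regular_imp_cycle U by blast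
    have ly: "card (set ys) = length ys" "3 \<le> length ys"
      using ys(2) by (auto simp: is_cycle_def distinct_card)
    have finU: "finite U" using fin by (simp add: U_def)
    have c: "card (U - set ys) + length ys = card U"
      using ys(1) ly(1) card_mono[OF finU ys(1)] by (simp add: card_Diff_subset)
    \<comment> \<open>A nonempty rest would have at least 3 vertices, making 9 in total.\<close>
    have "U - set ys = {}"
      using two_regular_card_ge_3[OF two_regular_diff_cycle[OF U ys(2)]] c cU ly(2) lx(2) by linarith
    then have part: "set xs \<inter> set ys = {}" "set xs \<union> set ys = W" and "card U = length ys"
      using ys(1) xs(1) c by (auto simp: U_def)
    then have "length xs = 4 \<and> length ys = 4 \<or> length xs = 3 \<and> length ys = 5
      \<or> length ys = 3 \<and> length xs = 5"
      using cU lx(2) ly(2) by arith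
    then show ?thesis
      using C4_C4[OF xs(2) ys(2)] C3_C5[OF xs(2) ys(2)] C3_C5[OF ys(2) xs(2)] part by blast
  qed
qed

section \<open>Non-neighbours in quintic graphs of order 8\<close>

text \<open>The neighbourhood function of the complement graph.\<close>

definition non_nbrs :: "'a set \<Rightarrow> 'a set set \<Rightarrow> 'a \<Rightarrow> 'a set" where
  "non_nbrs V E u = {v \<in> V. v \<noteq> u \<and> {u, v} \<notin> E}"

lemma incident_edges_eq_image:
  assumes "simple_graph V E"
  shows "incident_edges E u = (\<lambda>v. {u, v}) ` {v \<in> V. {u, v} \<in> E}"
proof -
  have "e \<in> (\<lambda>v. {u, v}) ` {v \<in> V. {u, v} \<in> E}" if "e \<in> E" "u \<in> e" for e
  proof -
    have "e \<subseteq> V" "card e = 2" using assms that by (auto simp: simple_graph_def)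
    then show ?thesis using that by (auto simp: card_2_iff insert_commute)
  qed
  then show ?thesis by (auto simp: incident_edges_def)
qed

text \<open>Of the 7 other vertices 5 are neighbours, which leaves 2.\<close>

lemma non_nbrs_two_regular:
  assumes G: "simple_graph V E" and card: "card V = 8" and reg: "regular_graph V E 5"
  shows "two_regular V (non_nbrs V E)"
proof -
  have fin: "finite V" using G by (simp add: simple_graph_def)
  have "card (non_nbrs V E u) = 2" if u: "u \<in> V" for u
  proof -
    let ?A = "{v \<in> V. {u, v} \<in> E}"
    have "inj_on (\<lambda>v. {u, v}) ?A" by (auto simp: inj_on_def doubleton_eq_iff)
    then have "card ?A = card (incident_edges E u)"
      unfolding incident_edges_eq_image[OF G] by (rule card_image[symmetric])
    then have A: "card ?A = 5" using reg u by (simp add: regular_graph_def)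
    have "{u} \<notin> E" using G by (auto simp: simple_graph_def)
    then have "non_nbrs V E u = V - insert u ?A" "u \<notin> ?A" by (auto simp: non_nbrs_def)
    moreover have "card (insert u ?A) = 6" using A fin \<open>u \<notin> ?A\<close> by simp
    ultimately show ?thesis using card fin u by (simp add: card_Diff_subset)
  qed
  then show ?thesis
    using fin by (auto simp: two_regular_def non_nbrs_def insert_commute)
qed

section \<open>Lower bound for the chromatic number\<close>

text \<open>With at most three classes of size at most 3, some class is smaller than 3, since 8 is
  not a multiple of 3. For \<open>x\<close> in it, some non-neighbour \<open>y\<close> of
  \<open>x\<close> has another colour. The class of \<open>y\<close> must then have size 3, so it
  contains all non-neighbours of \<open>y\<close>, among them \<open>x\<close>.\<close>

lemma colouring_ge_4:
  assumes reg: "two_regular V (non_nbrs V E)" and card: "card V = 8" and c: "proper_colouring V E c"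
  shows "4 \<le> card (c ` V)"
proof (rule ccontr)
  assume "\<not> 4 \<le> card (c ` V)"
  then have le3: "card (c ` V) \<le> 3" by simp
  let ?N = "non_nbrs V E"
  define C where "C k = {v \<in> V. c v = k}" for k
  have fin: "finite V" using reg by (simp add: two_regular_def)
  have finN: "finite (?N u)" for u using fin by (simp add: non_nbrs_def)
  have sub: "C (c u) \<subseteq> insert u (?N u)" if "u \<in> V" for u
    using c that unfolding C_def non_nbrs_def proper_colouring_def by force
  have cN: "card (insert u (?N u)) = 3" if "u \<in> V" for u
    using reg that finN by (simp add: two_regular_def card_insert_if subset_Diff_insert)
  have C3: "card (C k) \<le> 3" if "k \<in> c ` V" for k
    using that sub cN card_mono[OF _ sub] finN by fastforce
  have total: "(\<Sum>k\<in>c ` V. card (C k)) = 8"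
    using sum.image_gen[OF fin, of "\<lambda>_. 1 :: nat" c] card by (simp add: C_def)
  have "\<exists>r\<in>c ` V. card (C r) \<noteq> 3"
  proof (rule ccontr)
    assume "\<not> ?thesis"
    then have "(\<Sum>k\<in>c ` V. 3) = (8 :: nat)" using total by (metis (no_types, lifting) sum.cong)
    then have "card (c ` V) * 3 = 8" by simp
    then show False by presburger
  qed
  then obtain x where x: "x \<in> V" and "card (C (c x)) \<noteq> 3" by blast
  then have Cx: "card (C (c x)) \<le> 2" using C3[of "c x"] by auto
  have "\<not> insert x (?N x) \<subseteq> C (c x)"
    using card_mono[of "C (c x)" "insert x (?N x)"] Cx cN[OF x] fin by (auto simp: C_def)
  then obtain y where y: "y \<in> ?N x" "c y \<noteq> c x" "y \<in> V"
    using x by (auto simp: C_def non_nbrs_def)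
  have "card (C (c y)) = 3"
  proof (rule ccontr)
    assume "card (C (c y)) \<noteq> 3"
    then have Cy: "card (C (c y)) \<le> 2" using C3[of "c y"] y by auto
    \<comment> \<open>At most one colour is left, so at most 2 + 2 + 3 = 7 vertices would be
      covered.\<close>
    let ?R = "c ` V - {c x} - {c y}"
    have "card ?R \<le> 1" using le3 x y fin by (simp add: card_Diff_singleton_if)
    moreover have "(\<Sum>k\<in>?R. card (C k)) \<le> of_nat (card ?R) * 3"
      by (rule sum_bounded_above) (use C3 in auto)
    moreover have "(\<Sum>k\<in>c ` V. card (C k)) = card (C (c x)) + (card (C (c y)) + (\<Sum>k\<in>?R. card (C k)))"
      using x y fin by (simp add: sum.remove[of "c ` V" "c x"] sum.remove[of "c ` V - {c x}" "c y"])
    ultimately show False using total Cx Cy by simp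
  qed
  then have "C (c y) = insert y (?N y)"
    using card_subset_eq[OF _ sub[OF y(3)]] cN[OF y(3)] finN by simp
  moreover have "x \<in> ?N y" using y x by (auto simp: non_nbrs_def insert_commute)
  ultimately show False using y(2) by (auto simp: C_def)
qed

section \<open>Labelings given by a list of edges\<close>

text \<open>An edge list on the vertices 0, ..., 7 encodes a labeling: the edge at position \<open>k\<close> receives
  label \<open>k + 1\<close>. The \<open>i\<close>-th entry of \<open>nb\<close> lists the non-neighbours of \<open>i\<close>. The edge lists below
  were found by computer search.\<close>

definition label_sum :: "(nat \<times> nat) list \<Rightarrow> nat \<Rightarrow> nat" where
  "label_sum es i = (\<Sum>k\<leftarrow>[0..<length es]. if i = fst (es ! k) \<or> i = snd (es ! k) then Suc k else 0)"

text \<open>All quantifiers range over sets of lists, so that the predicate can be evaluated. The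
  last two conjuncts make \<open>es\<close> the complement of the graph described by
  \<open>nb\<close>.\<close>

definition is_certificate :: "nat list list \<Rightarrow> (nat \<times> nat) list \<Rightarrow> bool" where
  "is_certificate nb es \<longleftrightarrow> length nb = 8 \<and> distinct es \<and>
     card (label_sum es ` set [0..<8]) = 4 \<and>
     (\<forall>(i, j)\<in>set es. i < j \<and> j < 8 \<and> label_sum es i \<noteq> label_sum es j) \<and>
     (\<forall>js\<in>set nb. \<forall>j\<in>set js. j < 8) \<and>
     (\<forall>j\<in>set [0..<8]. \<forall>i\<in>set [0..<j]. j \<in> set (nb ! i) \<or> (i, j) \<in> set es) \<and>
     (\<forall>(i, j)\<in>set es. j \<notin> set (nb ! i))"

text \<open>The numbering \<open>vs\<close> carries \<open>es\<close> to an enumeration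
  \<open>h\<close> of \<open>E\<close>, and the labeling is the inverse of \<open>h\<close>. Vertex
  sums become the computed \<open>label_sum\<close>.\<close>

lemma certificate_imp_labeling:
  assumes G: "simple_graph V E" and vs: "distinct vs" "set vs = V" "length vs = 8"
    and cert: "is_certificate nb es"
    and nb: "\<And>i. i < 8 \<Longrightarrow> non_nbrs V E (vs ! i) = (!) vs ` set (nb ! i)"
  obtains f where "local_antimagic_labeling V E f"
    "card (vertex_sum E f ` V) = 4"
proof -
  let ?n = "8 :: nat"
  have inj: "vs ! i = vs ! j \<longleftrightarrow> i = j" if "i < ?n" "j < ?n" for i j
    using that vs by (simp add: nth_eq_iff_index_eq)
  have es: "distinct es" "\<And>i j. (i, j) \<in> set es \<Longrightarrow> i < j \<and> j < ?n \<and> label_sum es i \<noteq> label_sum es j"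
    using cert unfolding is_certificate_def by auto
  have nb_less: "j < ?n" if "i < ?n" "j \<in> set (nb ! i)" for i j
    using cert that unfolding is_certificate_def by auto
  have es_iff: "(i, j) \<in> set es \<longleftrightarrow> j \<notin> set (nb ! i)" if "i < j" "j < ?n" for i j
    using cert that unfolding is_certificate_def by (auto simp: Ball_def)
  have V: "V = (!) vs ` {..<?n}" using vs(2,3) by (auto simp: set_conv_nth)
  have E_iff: "{vs ! i, vs ! j} \<in> E \<longleftrightarrow> (i, j) \<in> set es" if ij: "i < j" "j < ?n" for i j
  proof -
    have "vs ! j \<in> non_nbrs V E (vs ! i) \<longleftrightarrow> j \<in> set (nb ! i)"
      using nb[of i] ij inj nb_less[of i] by fastforce
    moreover have "vs ! j \<in> non_nbrs V E (vs ! i) \<longleftrightarrow> {vs ! i, vs ! j} \<notin> E"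
      using ij inj[of j i] V by (auto simp: non_nbrs_def)
    ultimately show ?thesis using es_iff[OF ij] by blast
  qed
  \<comment> \<open>Labels start at 1 and list positions at 0.\<close>
  define h where "h k = {vs ! fst (es ! (k - 1)), vs ! snd (es ! (k - 1))}" for k
  have pair: "fst (es ! k) < snd (es ! k) \<and> snd (es ! k) < ?n" if "k < length es" for k
    using es(2)[of "fst (es ! k)" "snd (es ! k)"] that by simp
  have E: "E = h ` {1..length es}"
  proof (intro set_eqI iffI)
    fix e assume e: "e \<in> E"
    then have "e \<subseteq> V" "card e = 2" using G by (auto simp: simple_graph_def)
    then obtain u v where "e = {u, v}" "u \<noteq> v" "u \<in> V" "v \<in> V" by (auto simp: card_2_iff)
    then obtain i j where "e = {vs ! i, vs ! j}" "i < ?n" "j < ?n" "i \<noteq> j"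
      unfolding V by blast
    then have "\<exists>i j. e = {vs ! i, vs ! j} \<and> i < j \<and> j < ?n"
      by (metis insert_commute linorder_neqE_nat)
    then obtain i j where ij: "e = {vs ! i, vs ! j}" "i < j" "j < ?n" by blast
    then have "(i, j) \<in> set es" using E_iff e by blast
    then obtain k where "k < length es" "es ! k = (i, j)" by (auto simp: in_set_conv_nth)
    then have "e = h (Suc k)" "Suc k \<in> {1..length es}" using ij by (auto simp: h_def)
    then show "e \<in> h ` {1..length es}" by blast
  next
    fix e assume "e \<in> h ` {1..length es}"
    then obtain k where k: "k \<in> {1..length es}" "e = h k" by blast
    then have "k - 1 < length es" by auto
    then show "e \<in> E"
      using k(2) pair[of "k - 1"] E_iff[of "fst (es ! (k - 1))" "snd (es ! (k - 1))"]
      by (simp add: h_def)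
  qed
  have injh: "inj_on h {1..length es}"
  proof (rule inj_onI)
    fix k l assume kl: "k \<in> {1..length es}" "l \<in> {1..length es}" "h k = h l"
    then have lt: "k - 1 < length es" "l - 1 < length es" by auto
    \<comment> \<open>Both pairs are increasing, so equal unordered pairs are equal as ordered
      ones.\<close>
    have "es ! (k - 1) = es ! (l - 1)"
      using kl(3) pair[OF lt(1)] pair[OF lt(2)] unfolding h_def doubleton_eq_iff
      by (auto simp: inj prod_eq_iff)
    then have "k - 1 = l - 1" using es(1) lt by (simp add: nth_eq_iff_index_eq)
    then show "k = l" using kl by auto
  qed
  have cardE: "card E = length es" using E injh by (simp add: card_image)
  define f where "f = the_inv_into {1..length es} h"
  have bij: "bij_betw f E {1..card E}"
    unfolding f_def cardE by (rule bij_betw_the_inv_into) (use E injh in \<open>simp add: bij_betw_def\<close>)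
  have fh: "f (h k) = k" if "k \<in> {1..length es}" for k
    using the_inv_into_f_f[OF injh that] by (simp add: f_def)
  have sum: "vertex_sum E f (vs ! i) = label_sum es i" if i: "i < ?n" for i
  proof -
    let ?K = "{k \<in> {1..length es}. vs ! i \<in> h k}"
    have "incident_edges E (vs ! i) = h ` ?K" by (auto simp: incident_edges_def E)
    moreover have "inj_on h ?K" using injh by (rule inj_on_subset) auto
    ultimately have "vertex_sum E f (vs ! i) = (\<Sum>k\<in>?K. k)"
      by (simp add: vertex_sum_def sum.reindex fh)
    also have "\<dots> = (\<Sum>k\<in>{1..length es}. if vs ! i \<in> h k then k else 0)"
      by (rule sum.inter_filter) simp
    also have "\<dots> = (\<Sum>k\<in>{0..<length es}. if vs ! i \<in> h (Suc k) then Suc k else 0)"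
      using sum.shift_bounds_Suc_ivl[of "\<lambda>k. if vs ! i \<in> h k then k else 0" 0 "length es"]
      by (simp add: atLeastLessThanSuc_atLeastAtMost)
    also have "\<dots> = (\<Sum>k\<in>{0..<length es}. if i = fst (es ! k) \<or> i = snd (es ! k) then Suc k else 0)"
    proof (rule sum.cong[OF refl])
      fix k assume "k \<in> {0..<length es}"
      then have "vs ! i \<in> h (Suc k) \<longleftrightarrow> i = fst (es ! k) \<or> i = snd (es ! k)"
        using i pair[of k] by (auto simp: h_def inj)
      then show "(if vs ! i \<in> h (Suc k) then Suc k else 0) =
        (if i = fst (es ! k) \<or> i = snd (es ! k) then Suc k else 0)" by simp
    qed
    finally show ?thesis by (simp add: label_sum_def interv_sum_list_conv_sum_set_nat)
  qed
  have "vertex_sum E f u \<noteq> vertex_sum E f v" if uv: "{u, v} \<in> E" for u v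
  proof -
    obtain k where k: "k \<in> {1..length es}" "{u, v} = h k" using uv E by blast
    then have lt: "k - 1 < length es" by auto
    obtain i j where ij: "es ! (k - 1) = (i, j)" by fastforce
    then have "(i, j) \<in> set es" using lt by (metis nth_mem)
    then have "i < ?n" "j < ?n" "label_sum es i \<noteq> label_sum es j" using es(2)[of i j] by auto
    moreover have "u = vs ! i \<and> v = vs ! j \<or> u = vs ! j \<and> v = vs ! i"
      using k(2) ij by (simp add: h_def doubleton_eq_iff)
    ultimately show ?thesis using sum by auto
  qed
  then have "local_antimagic_labeling V E f"
    using bij by (simp add: local_antimagic_labeling_def)
  moreover have "vertex_sum E f ` V = label_sum es ` set [0..<8]"
    using sum by (auto simp: V image_image)
  then have "card (vertex_sum E f ` V) = 4"
    using cert by (simp add: is_certificate_def del: set_upt)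
  ultimately show ?thesis using that by blast
qed

section \<open>Labelings for the three possible complements\<close>

text \<open>The sums at 0, ..., 7 are 63, 63, 44, 44, 43, 43, 60, 60; equal sums occur at
  consecutive vertices of the complement cycle.\<close>

lemma certificate_C8:
  "is_certificate [[1,7],[2,0],[3,1],[4,2],[5,3],[6,4],[7,5],[0,6]]
    [(2,7), (2,5), (3,5), (4,6), (0,3), (3,6), (1,4), (2,4), (0,5), (4,7), (1,3), (1,6), (5,7),
      (0,4), (0,2), (1,5), (1,7), (2,6), (3,7), (0,6)]"
  by code_simp

text \<open>The sums at 0, ..., 7 are 45, 45, 55, 55, 46, 46, 64, 64.\<close>

lemma certificate_C4_C4:
  "is_certificate [[1,3],[2,0],[3,1],[0,2],[5,7],[6,4],[7,5],[4,6]]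
    [(0,7), (1,4), (3,5), (4,6), (1,3), (2,5), (0,5), (2,4), (0,2), (1,5), (0,6), (1,7), (3,7),
      (2,6), (3,4), (1,6), (0,4), (2,7), (3,6), (5,7)]"
  by code_simp

text \<open>The sums at 0, ..., 7 are 53, 53, 53, 50, 50, 44, 44, 73; the triangle 0, 1, 2 of the
  complement is one class.\<close>

lemma certificate_C3_C5:
  "is_certificate [[1,2],[2,0],[0,1],[4,7],[5,3],[6,4],[7,5],[3,6]]
    [(4,6), (1,5), (1,3), (0,6), (0,5), (2,3), (0,4), (2,7), (2,6), (3,5), (4,7), (2,5), (1,4),
      (3,6), (5,7), (1,6), (0,3), (2,4), (1,7), (0,7)]"
  by code_simp

text \<open>Listing the complement cycles one after the other numbers the vertices so that the
  non-neighbours follow the table of the matching certificate.\<close>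

lemma labeling_with_4_sums:
  assumes G: "simple_graph V E" and reg: "two_regular V (non_nbrs V E)" and card: "card V = 8"
  obtains f where "local_antimagic_labeling V E f" "card (vertex_sum E f ` V) = 4"
  using reg card
proof (cases rule: two_regular_card_8_cases)
  case (C8 xs)
  have nb: "non_nbrs V E (xs ! i) =
      (!) xs ` set ([[1,7],[2,0],[3,1],[4,2],[5,3],[6,4],[7,5],[0,6]] ! i)" if "i < 8" for i
    using less_8_cases[OF that]
    by (elim disjE)
      (simp_all add: numeral_2_eq_2[symmetric] is_cycle_nth[OF C8(1)] C8(2))
  have "distinct xs" using C8(1) by (simp add: is_cycle_def)
  from certificate_imp_labeling[OF G this C8(3,2) certificate_C8 nb] show ?thesis using that by metis
next
  case (C4_C4 xs ys)
  have nb: "non_nbrs V E ((xs @ ys) ! i) =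
      (!) (xs @ ys) ` set ([[1,3],[2,0],[3,1],[0,2],[5,7],[6,4],[7,5],[4,6]] ! i)" if "i < 8" for i
    using less_8_cases[OF that]
    by (elim disjE)
      (simp_all add: numeral_2_eq_2[symmetric] nth_append is_cycle_nth[OF C4_C4(1)]
        is_cycle_nth[OF C4_C4(2)] C4_C4(3,4))
  have "distinct (xs @ ys)" "set (xs @ ys) = V" "length (xs @ ys) = 8"
    using C4_C4 by (simp_all add: is_cycle_def)
  from certificate_imp_labeling[OF G this certificate_C4_C4 nb] show ?thesis using that by metis
next
  case (C3_C5 xs ys)
  have nb: "non_nbrs V E ((xs @ ys) ! i) =
      (!) (xs @ ys) ` set ([[1,2],[2,0],[0,1],[4,7],[5,3],[6,4],[7,5],[3,6]] ! i)" if "i < 8" for i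
    using less_8_cases[OF that]
    by (elim disjE)
      (simp_all add: numeral_2_eq_2[symmetric] nth_append is_cycle_nth[OF C3_C5(1)]
        is_cycle_nth[OF C3_C5(2)] C3_C5(3,4))
  have "distinct (xs @ ys)" "set (xs @ ys) = V" "length (xs @ ys) = 8"
    using C3_C5 by (simp_all add: is_cycle_def)
  from certificate_imp_labeling[OF G this certificate_C3_C5 nb] show ?thesis using that by metis
qed

section \<open>Comparison of the two invariants\<close>

text \<open>The vertex sums of a labeling are a proper colouring, so the infimum on the right is
  over a smaller set.\<close>

lemma chromatic_number_le_local_antimagic:
  "chromatic_number V E \<le> local_antimagic_chromatic_number V E"
  unfolding chromatic_number_def local_antimagic_chromatic_number_def
  by (rule Inf_superset_mono)
    (auto simp: local_antimagic_labeling_def proper_colouring_def)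

theorem theorem2p6:
  fixes V :: "'a set" and E :: "'a set set"
  assumes "simple_graph V E"
    and "card V = 8"
    and "regular_graph V E 5"
  shows "local_antimagic_chromatic_number V E = chromatic_number V E \<and>
         chromatic_number V E = 4"
proof -
  have reg: "two_regular V (non_nbrs V E)" using non_nbrs_two_regular[OF assms] .
  have 4: "enat 4 = 4" by (simp add: numeral_eq_enat)
  have "4 \<le> chromatic_number V E"
    unfolding chromatic_number_def
    using colouring_ge_4[OF reg assms(2)] by (auto intro!: Inf_greatest simp flip: 4)
  moreover obtain f where f: "local_antimagic_labeling V E f" "card (vertex_sum E f ` V) = 4"
    using labeling_with_4_sums[OF assms(1) reg assms(2)] .
  have "local_antimagic_chromatic_number V E \<le> 4"
    unfolding local_antimagic_chromatic_number_def
    by (rule Inf_lower) (use f 4 in force)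
  \<comment> \<open>Both invariants are squeezed between 4 and 4.\<close>
  ultimately show ?thesis
    using chromatic_number_le_local_antimagic[of V E] by auto
qed

end
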